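(* Let $\mathcal{A}\in T_{m,n}$ be an even order column competent tensor such that the auxiliary matrix $\bar{A}$ of $\mathcal{A}$ is of the form $\bar{A}=\begin{pmatrix} M(\mathcal{A}) & O\\ O & O\end{pmatrix}$. Then for all vectors $q\in\mathbb{R}^n$, any $\omega$-solution of the TCP$(q,\mathcal{A})$, if it exists, is locally $\omega$-unique.
   Context: $T_{m,n}$ is the set of real tensors $\mathcal{A}=(a_{i_1 i_2\ldots i_m})$ of order $m$ and dimension $n$ (with $i_1,\ldots,i_m\in[n]=\{1,\ldots,n\}$, $m,n\ge 2$). For $x\in\mathbb{R}^n$, $\mathcal{A}x^{m-1}\in\mathbb{R}^n$ is the vector with $(\mathcal{A}x^{m-1})_i=\sum_{i_2,\ldots,i_m=1}^n a_{i i_2\ldots i_m}x_{i_2}\cdots x_{i_m}$. A tensor $\mathcal{A}\in T_{m,n}$ is column competent if, for $x\in\mathbb{R}^n$, $x_i(\mathcal{A}x^{m-1})_i=0$ for all $i\in[n]$ implies $\mathcal{A}x^{m-1}=0$. The majorization matrix $M(\mathcal{A})$ is the $n\times n$ matrix with entries $M(\mathcal{A})_{ij}=a_{ijj\ldots j}$. Auxiliary matrix: let $N=\binom{m+n-2}{n-1}$ be the number of monomials of degree $m-1$ in $x_1,\ldots,x_n$. For $x\in\mathbb{R}^n$ let $y=(y_1,\ldots,y_N)^T$ list these monomials, with $y_i=x_i^{m-1}$ for $i\in[n]$ and $y_{n+1},\ldots,y_N$ the remaining monomials in a fixed order (modified graded lexicographic order). Let $A\in\mathbb{R}^{n\times N}$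 be the matrix with $\mathcal{A}x^{m-1}=Ay$ identically in $x$. The auxiliary matrix of $\mathcal{A}$ is $\bar{A}=\begin{pmatrix}A\\ O\end{pmatrix}\in\mathbb{R}^{N\times N}$, with $O$ the $(N-n)\times N$ zero matrix. TCP$(q,\mathcal{A})$: find $x\in\mathbb{R}^n$ with $x\ge 0$, $\omega=\mathcal{A}x^{m-1}+q\ge 0$, $x^T\omega=0$; $\omega$ is an $\omega$-solution if there is $x$ such that $(\omega,x)$ solves this problem. An $\omega$-solution $\tilde{\omega}$ is locally $\omega$-unique if there is a neighborhood of $\tilde{\omega}$ within which $\tilde{\omega}$ is the only $\omega$-solution. *)

theory Defs
  imports
    Complex_Main
    "HOL-Library.FuncSet"
    "HOL-Library.List_Lexorder"
    "HOL-Computational_Algebra.Polynomial"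
    "Jordan_Normal_Form.Matrix"
begin

text \<open>Indices are 0-based: \<open>[n]\<close> is rendered as \<open>{..<n}\<close>. Vectors of dimension \<open>n\<close>
  are elements of \<open>carrier_vec n\<close>; the order on \<open>real vec\<close> is the componentwise one.\<close>

definition multi_indices :: "nat \<Rightarrow> nat \<Rightarrow> nat list set" where
  "multi_indices k n = {is. set is \<subseteq> {..<n} \<and> length is = k}"

text \<open>A tensor maps the list \<open>[i\<^sub>1, \<dots>, i\<^sub>m]\<close> to the entry with these indices.\<close>

definition tensors :: "nat \<Rightarrow> nat \<Rightarrow> (nat list \<Rightarrow> real) set" where
  "tensors m n = multi_indices m n \<rightarrow>\<^sub>E UNIV"

definition tensor_apply :: "nat \<Rightarrow> nat \<Rightarrow> (nat list \<Rightarrow> real) \<Rightarrow> real vec \<Rightarrow> real vec" where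
  "tensor_apply m n \<A> x =
     vec n (\<lambda>i. \<Sum>is\<in>multi_indices (m - 1) n. \<A> (i # is) * (\<Prod>j\<leftarrow>is. x $ j))"

definition column_competent :: "nat \<Rightarrow> nat \<Rightarrow> (nat list \<Rightarrow> real) \<Rightarrow> bool" where
  "column_competent m n \<A> \<longleftrightarrow>
     (\<forall>x\<in>carrier_vec n.
        (\<forall>i<n. x $ i * tensor_apply m n \<A> x $ i = 0) \<longrightarrow> tensor_apply m n \<A> x = 0\<^sub>v n)"

definition majorization_matrix :: "nat \<Rightarrow> nat \<Rightarrow> (nat list \<Rightarrow> real) \<Rightarrow> real mat" where
  "majorization_matrix m n \<A> = mat n n (\<lambda>(i, j). \<A> (i # replicate (m - 1) j))"


text \<open>A monomial in \<open>n\<close> variables is represented by its list of exponents.\<close>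

definition exponents :: "nat \<Rightarrow> nat \<Rightarrow> nat list set" where
  "exponents m n = {e. length e = n \<and> sum_list e = m - 1}"

definition pure_powers :: "nat \<Rightarrow> nat \<Rightarrow> nat list list" where
  "pure_powers m n = map (\<lambda>i. (replicate n 0)[i := m - 1]) [0..<n]"

text \<open>All monomials have the same degree, so the graded lexicographic order is the
  lexicographic order on exponent lists, listed from the largest to the smallest (\<open>x\<^sub>0\<close> being
  the largest variable). It is modified in that the pure powers come first.\<close>

definition monomials :: "nat \<Rightarrow> nat \<Rightarrow> nat list list" where
  "monomials m n =
     pure_powers m n @ rev (sorted_list_of_set (exponents m n - set (pure_powers m n)))"

definition num_monomials :: "nat \<Rightarrow> nat \<Rightarrow> nat" where
  "num_monomials m n = (m + n - 2) choose (n - 1)"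

definition monomial_vec :: "nat \<Rightarrow> nat \<Rightarrow> real vec \<Rightarrow> real vec" where
  "monomial_vec m n x =
     vec (num_monomials m n) (\<lambda>k. \<Prod>i<n. x $ i ^ (monomials m n ! k ! i))"

text \<open>Existence and uniqueness of this matrix are shown in \<open>coefficient_matrix_ex1\<close>.\<close>

definition coefficient_matrix :: "nat \<Rightarrow> nat \<Rightarrow> (nat list \<Rightarrow> real) \<Rightarrow> real mat" where
  "coefficient_matrix m n \<A> =
     (THE A. A \<in> carrier_mat n (num_monomials m n) \<and>
        (\<forall>x\<in>carrier_vec n. tensor_apply m n \<A> x = A *\<^sub>v monomial_vec m n x))"

definition auxiliary_matrix :: "nat \<Rightarrow> nat \<Rightarrow> (nat list \<Rightarrow> real) \<Rightarrow> real mat" where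
  "auxiliary_matrix m n \<A> =
     coefficient_matrix m n \<A> @\<^sub>r 0\<^sub>m (num_monomials m n - n) (num_monomials m n)"


definition TCP_solution ::
  "nat \<Rightarrow> nat \<Rightarrow> real vec \<Rightarrow> (nat list \<Rightarrow> real) \<Rightarrow> real vec \<Rightarrow> real vec \<Rightarrow> bool" where
  "TCP_solution m n q \<A> \<omega> x \<longleftrightarrow>
     x \<in> carrier_vec n \<and> 0\<^sub>v n \<le> x \<and>
     \<omega> = tensor_apply m n \<A> x + q \<and> 0\<^sub>v n \<le> \<omega> \<and> x \<bullet> \<omega> = 0"

definition omega_solution ::
  "nat \<Rightarrow> nat \<Rightarrow> real vec \<Rightarrow> (nat list \<Rightarrow> real) \<Rightarrow> real vec \<Rightarrow> bool" where
  "omega_solution m n q \<A> \<omega> \<longleftrightarrow> (\<exists>x. TCP_solution m n q \<A> \<omega> x)"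

text \<open>The type \<open>real vec\<close> carries no topology, hence the explicit Euclidean distance.\<close>

definition vec_dist :: "real vec \<Rightarrow> real vec \<Rightarrow> real" where
  "vec_dist v w = sqrt ((v - w) \<bullet> (v - w))"

definition locally_omega_unique ::
  "nat \<Rightarrow> nat \<Rightarrow> real vec \<Rightarrow> (nat list \<Rightarrow> real) \<Rightarrow> real vec \<Rightarrow> bool" where
  "locally_omega_unique m n q \<A> \<omega>' \<longleftrightarrow>
     omega_solution m n q \<A> \<omega>' \<and>
     (\<exists>\<epsilon>>0. \<forall>\<omega>. omega_solution m n q \<A> \<omega> \<and> vec_dist \<omega> \<omega>' < \<epsilon> \<longrightarrow> \<omega> = \<omega>')"


lemma finite_multi_indices: "finite (multi_indices k n)"
  unfolding multi_indices_def by (rule finite_lists_length_eq) simp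

lemma card_exponents:
  assumes "m \<ge> 2" "n \<ge> 2"
  shows "card (exponents m n) = num_monomials m n"
proof -
  have "card (exponents m n) = (m - 1 + n - 1) choose (m - 1)"
    unfolding exponents_def by (rule card_length_sum_list)
  also have "m - 1 + n - 1 = m + n - 2" using assms by simp
  also have "(m + n - 2) choose (m - 1) = (m + n - 2) choose (m + n - 2 - (m - 1))"
    by (rule binomial_symmetric) (use assms in simp)
  also have "m + n - 2 - (m - 1) = n - 1" using assms by simp
  finally show ?thesis unfolding num_monomials_def .
qed

lemma finite_exponents:
  assumes "m \<ge> 2" "n \<ge> 2"
  shows "finite (exponents m n)"
proof -
  have "num_monomials m n > 0" using assms unfolding num_monomials_def by simp
  then show ?thesis using card_exponents[OF assms] by (metis card.infinite less_irrefl)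
qed

lemma distinct_pure_powers:
  assumes "m \<ge> 2"
  shows "distinct (pure_powers m n)"
  unfolding pure_powers_def distinct_map
proof (intro conjI inj_onI)
  fix i j
  assume ij: "i \<in> set [0..<n]" "j \<in> set [0..<n]"
    "(replicate n (0::nat))[i := m - 1] = (replicate n 0)[j := m - 1]"
  then have "(replicate n (0::nat))[i := m - 1] ! i = (replicate n 0)[j := m - 1] ! i" by simp
  then show "i = j" using ij(1,2) assms by (auto simp: nth_list_update split: if_splits)
qed simp

lemma pure_powers_subset: "set (pure_powers m n) \<subseteq> exponents m n"
  unfolding pure_powers_def exponents_def by (auto simp: sum_list_update)

lemma set_monomials:
  assumes "m \<ge> 2" "n \<ge> 2"
  shows "set (monomials m n) = exponents m n"
  using pure_powers_subset[of m n] finite_exponents[OF assms]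
  unfolding monomials_def by auto

lemma distinct_monomials:
  assumes "m \<ge> 2" "n \<ge> 2"
  shows "distinct (monomials m n)"
  using distinct_pure_powers[of m n] finite_exponents[OF assms] assms
  unfolding monomials_def by auto

lemma length_monomials:
  assumes "m \<ge> 2" "n \<ge> 2"
  shows "length (monomials m n) = num_monomials m n"
  using distinct_card[OF distinct_monomials[OF assms]] set_monomials[OF assms]
    card_exponents[OF assms] by simp

lemma monomial_vec_pure:
  assumes "m \<ge> 2" "n \<ge> 2" "k < n"
  shows "k < num_monomials m n" "monomial_vec m n x $ k = x $ k ^ (m - 1)"
proof -
  have "length (pure_powers m n) = n" unfolding pure_powers_def by simp
  then show k: "k < num_monomials m n"
    using assms length_monomials[OF assms(1,2)] unfolding monomials_def by simp
  have "monomials m n ! k = (replicate n 0)[k := m - 1]"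
    using assms(3) unfolding monomials_def pure_powers_def by (simp add: nth_append)
  then have "monomial_vec m n x $ k = (\<Prod>i<n. x $ i ^ ((replicate n 0)[k := m - 1] ! i))"
    using k unfolding monomial_vec_def by simp
  also have "\<dots> = (\<Prod>i<n. if i = k then x $ i ^ (m - 1) else 1)"
    by (rule prod.cong) (auto simp: nth_list_update)
  also have "\<dots> = x $ k ^ (m - 1)" using assms(3) by simp
  finally show "monomial_vec m n x $ k = x $ k ^ (m - 1)" .
qed

lemma prod_list_count:
  fixes f :: "nat \<Rightarrow> real"
  assumes "set is \<subseteq> {..<n}"
  shows "(\<Prod>j\<leftarrow>is. f j) = (\<Prod>i<n. f i ^ count_list is i)"
  using assms
proof (induction "is")
  case (Cons a "is")
  have "(\<Prod>i<n. f i ^ count_list (a # is) i)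
      = (\<Prod>i<n. (if i = a then f i else 1) * f i ^ count_list is i)"
    by (auto intro!: prod.cong)
  also have "\<dots> = f a * (\<Prod>i<n. f i ^ count_list is i)"
    using Cons.prems by (simp add: prod.distrib)
  finally show ?case using Cons by simp
qed simp

lemma count_list_exponents:
  assumes "is \<in> multi_indices (m - 1) n"
  shows "map (count_list is) [0..<n] \<in> exponents m n"
proof -
  have *: "set is \<subseteq> {..<n}" "length is = m - 1" using assms unfolding multi_indices_def by auto
  have "sum_list (map (count_list is) [0..<n]) = (\<Sum>i<n. count_list is i)"
    by (simp add: interv_sum_list_conv_sum_set_nat atLeast0LessThan)
  also have "\<dots> = (\<Sum>i\<in>set is. count_list is i)"
    using *(1) by (intro sum.mono_neutral_right) (auto simp: count_list_0_iff)
  also have "\<dots> = m - 1" using *(2) by (simp add: sum_count_set)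
  finally show ?thesis unfolding exponents_def by simp
qed

lemma coefficient_matrix_exists:
  assumes "m \<ge> 2" "n \<ge> 2"
  shows "\<exists>A \<in> carrier_mat n (num_monomials m n).
     \<forall>x\<in>carrier_vec n. tensor_apply m n \<A> x = A *\<^sub>v monomial_vec m n x"
proof -
  define N where "N = num_monomials m n"
  define I where "I = multi_indices (m - 1) n"
  define g where "g = (\<lambda>is. map (count_list is) [0..<n])"
  define c where "c = (\<lambda>i e. \<Sum>is\<in>{is\<in>I. g is = e}. \<A> (i # is))"
  define A where "A = mat n N (\<lambda>(i, k). c i (monomials m n ! k))"
  have len: "length (monomials m n) = N" using length_monomials[OF assms] unfolding N_def .
  have "tensor_apply m n \<A> x = A *\<^sub>v monomial_vec m n x" for x
  proof (rule eq_vecI)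
    fix i assume "i < dim_vec (A *\<^sub>v monomial_vec m n x)"
    then have i: "i < n" unfolding A_def by simp
    define p where "p = (\<lambda>e. \<Prod>l<n. x $ l ^ (e ! l))"
    have p: "(\<Prod>j\<leftarrow>is. x $ j) = p (g is)" if "is \<in> I" for "is"
      using that prod_list_count[of "is" n "\<lambda>j. x $ j"]
      unfolding I_def multi_indices_def p_def g_def by simp
    have "tensor_apply m n \<A> x $ i = (\<Sum>is\<in>I. \<A> (i # is) * p (g is))"
      using i p unfolding tensor_apply_def I_def by simp
    also have "\<dots> = (\<Sum>e\<in>exponents m n. \<Sum>is\<in>{is\<in>I. g is = e}. \<A> (i # is) * p (g is))"
      by (rule sum.group[symmetric])
        (use finite_multi_indices finite_exponents[OF assms] count_list_exponents in
          \<open>auto simp: I_def g_def\<close>)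
    also have "\<dots> = (\<Sum>e\<in>exponents m n. c i e * p e)"
      by (auto simp: c_def sum_distrib_right intro!: sum.cong)
    also have "\<dots> = (\<Sum>k<N. c i (monomials m n ! k) * p (monomials m n ! k))"
      by (rule sum.reindex_bij_betw[symmetric])
        (rule bij_betw_nth[OF distinct_monomials[OF assms]],
          use len set_monomials[OF assms] in auto)
    also have "\<dots> = (A *\<^sub>v monomial_vec m n x) $ i"
      using i unfolding A_def monomial_vec_def p_def N_def
      by (simp add: scalar_prod_def atLeast0LessThan)
    finally show "tensor_apply m n \<A> x $ i = (A *\<^sub>v monomial_vec m n x) $ i" .
  qed (simp add: tensor_apply_def A_def)
  moreover have "A \<in> carrier_mat n N" unfolding A_def by simp
  ultimately show ?thesis unfolding N_def by blast
qed

text \<open>Reading an exponent list as the digits of a number in base \<open>m\<close> separates the monomials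
  on the curve \<open>x\<^sub>i = t ^ (m ^ i)\<close>.\<close>

lemma digits_inj:
  fixes e f :: "nat list"
  assumes "length e = length f" "\<forall>a\<in>set e. a < m" "\<forall>a\<in>set f. a < m"
    and "(\<Sum>i<length e. m ^ i * e ! i) = (\<Sum>i<length f. m ^ i * f ! i)"
  shows "e = f"
  using assms
proof (induction e f rule: list_induct2)
  case (Cons a e b f)
  have eq: "a + m * (\<Sum>i<length e. m ^ i * e ! i) = b + m * (\<Sum>i<length f. m ^ i * f ! i)"
    using Cons.prems(3)
    by (simp add: sum.lessThan_Suc_shift sum_distrib_left mult.assoc del: sum.lessThan_Suc)
  have "a < m" "b < m" using Cons.prems by auto
  then have "a = b" using arg_cong[OF eq, of "\<lambda>z. z mod m"] by simp
  then show ?case using eq Cons \<open>a < m\<close> by auto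
qed simp

lemma monomial_vec_independent:
  assumes "m \<ge> 2" "n \<ge> 2"
    and "\<And>x. x \<in> carrier_vec n \<Longrightarrow> (\<Sum>k<num_monomials m n. d k * monomial_vec m n x $ k) = 0"
    and "k < num_monomials m n"
  shows "d k = 0"
proof -
  define N where "N = num_monomials m n"
  define w where "w = (\<lambda>k. \<Sum>i<n. m ^ i * monomials m n ! k ! i)"
  have mon: "monomials m n ! k \<in> exponents m n" if "k < N" for k
    using that set_monomials[OF assms(1,2)] length_monomials[OF assms(1,2)]
    unfolding N_def by (metis nth_mem)
  have inj: "j = k" if "j < N" "k < N" "w j = w k" for j k
  proof -
    have "\<forall>a\<in>set e. a < m" if "e \<in> exponents m n" for e
      using that member_le_sum_list[of _ e] assms(1) unfolding exponents_def by fastforce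
    then have "monomials m n ! j = monomials m n ! k"
      using mon[OF that(1)] mon[OF that(2)] that(3)
      by (intro digits_inj[where m = m]) (auto simp: exponents_def w_def)
    then show ?thesis
      using that(1,2) distinct_monomials[OF assms(1,2)] length_monomials[OF assms(1,2)]
      unfolding N_def by (simp add: nth_eq_iff_index_eq)
  qed
  define P where "P = (\<Sum>k<N. monom (d k) (w k))"
  have "poly P t = 0" for t
  proof -
    define x where "x = vec n (\<lambda>i. t ^ (m ^ i))"
    have "monomial_vec m n x $ k = t ^ w k" if "k < N" for k
      using that unfolding monomial_vec_def x_def w_def N_def
      by (simp add: power_mult[symmetric] power_sum)
    then have "poly P t = (\<Sum>k<N. d k * monomial_vec m n x $ k)"
      unfolding P_def by (simp add: poly_sum poly_monom)
    also have "\<dots> = 0" using assms(3)[of x] unfolding x_def N_def by simp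
    finally show ?thesis .
  qed
  then have "P = 0" using poly_all_0_iff_0 by blast
  then have "0 = coeff P (w k)" by simp
  also have "\<dots> = (\<Sum>j<N. if j = k then d j else 0)"
    unfolding P_def coeff_sum using inj assms(4) N_def by (intro sum.cong) auto
  also have "\<dots> = d k" using assms(4) unfolding N_def by simp
  finally show ?thesis by simp
qed

lemma coefficient_matrix_ex1:
  assumes "m \<ge> 2" "n \<ge> 2"
  shows "\<exists>!A. A \<in> carrier_mat n (num_monomials m n) \<and>
     (\<forall>x\<in>carrier_vec n. tensor_apply m n \<A> x = A *\<^sub>v monomial_vec m n x)"
proof (rule ex_ex1I)
  show "\<exists>A. A \<in> carrier_mat n (num_monomials m n) \<and>
     (\<forall>x\<in>carrier_vec n. tensor_apply m n \<A> x = A *\<^sub>v monomial_vec m n x)"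
    using coefficient_matrix_exists[OF assms] by blast
next
  fix A B
  assume A: "A \<in> carrier_mat n (num_monomials m n) \<and>
      (\<forall>x\<in>carrier_vec n. tensor_apply m n \<A> x = A *\<^sub>v monomial_vec m n x)"
    and B: "B \<in> carrier_mat n (num_monomials m n) \<and>
      (\<forall>x\<in>carrier_vec n. tensor_apply m n \<A> x = B *\<^sub>v monomial_vec m n x)"
  show "A = B"
  proof (rule eq_matI)
    fix i k assume ik: "i < dim_row B" "k < dim_col B"
    have "A $$ (i, k) - B $$ (i, k) = 0"
    proof (rule monomial_vec_independent[OF assms, where d = "\<lambda>k. A $$ (i, k) - B $$ (i, k)"])
      fix x :: "real vec" assume "x \<in> carrier_vec n"
      then have eq: "(A *\<^sub>v monomial_vec m n x) $ i = (B *\<^sub>v monomial_vec m n x) $ i"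
        using A B by metis
      have row: "(C *\<^sub>v monomial_vec m n x) $ i
          = (\<Sum>k<num_monomials m n. C $$ (i, k) * monomial_vec m n x $ k)"
        if "C \<in> carrier_mat n (num_monomials m n)" for C
        using that ik B
        by (auto simp: scalar_prod_def monomial_vec_def atLeast0LessThan intro!: sum.cong)
      show "(\<Sum>k<num_monomials m n. (A $$ (i, k) - B $$ (i, k)) * monomial_vec m n x $ k) = 0"
        using eq row[of A] row[of B] A B by (simp add: left_diff_distrib sum_subtractf)
    qed (use ik B in auto)
    then show "A $$ (i, k) = B $$ (i, k)" by simp
  qed (use A B in auto)
qed

lemma coefficient_matrix:
  assumes "m \<ge> 2" "n \<ge> 2"
  shows "coefficient_matrix m n \<A> \<in> carrier_mat n (num_monomials m n)"
    and "x \<in> carrier_vec n \<Longrightarrow>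
      tensor_apply m n \<A> x = coefficient_matrix m n \<A> *\<^sub>v monomial_vec m n x"
  using theI'[OF coefficient_matrix_ex1[OF assms, of \<A>]]
  unfolding coefficient_matrix_def by blast+

end

(* The block form of the auxiliary matrix says that A x^(m-1) is M(A) applied to the vector of
   powers x_j^(m-1).  Since m - 1 is odd, these power vectors fill the whole of R^n, and x_j
   vanishes iff its power does.  Hence for solutions (w, x), (w', x') there is a y with
   y_j^(m-1) = x_j^(m-1) - x'_j^(m-1) and A y^(m-1) = w - w'.  If w and w' have the same zero
   set, complementarity makes every y_i (w - w')_i vanish, so column competence gives w = w'.
   A solution w is thus determined by its zero set, and there are at most 2^n of them. *)

theory Submission
  imports Defs
begin

text \<open>The first \<open>n\<close> monomials are the pure powers, and the block form makes every
  later column of the coefficient matrix zero.\<close>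

lemma tensor_apply_majorization:
  assumes "m \<ge> 2" and "n \<ge> 2"
    and aux: "auxiliary_matrix m n \<A> =
      four_block_mat (majorization_matrix m n \<A>) (0\<^sub>m n (num_monomials m n - n))
        (0\<^sub>m (num_monomials m n - n) n) (0\<^sub>m (num_monomials m n - n) (num_monomials m n - n))"
    and x: "x \<in> carrier_vec n" and i: "i < n"
  shows "tensor_apply m n \<A> x $ i
    = (\<Sum>j<n. majorization_matrix m n \<A> $$ (i, j) * x $ j ^ (m - 1))"
proof -
  define N where "N = num_monomials m n"
  define C where "C = coefficient_matrix m n \<A>"
  have C: "C \<in> carrier_mat n N"
    and tensor: "tensor_apply m n \<A> x = C *\<^sub>v monomial_vec m n x"
    using coefficient_matrix[OF assms(1,2), where \<A> = \<A>] x unfolding C_def N_def by auto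
  \<comment> \<open>The pure power with index \<open>n - 1\<close> is among the \<open>N\<close>
    monomials.\<close>
  have "n \<le> N"
    using monomial_vec_pure(1)[OF assms(1,2), of "n - 1"] assms(2) unfolding N_def by simp
  have entry: "C $$ (i, k) = (if k < n then majorization_matrix m n \<A> $$ (i, k) else 0)"
    if "k < N" for k
  proof -
    have "C $$ (i, k) = auxiliary_matrix m n \<A> $$ (i, k)"
      using C i that unfolding auxiliary_matrix_def append_rows_def C_def N_def by auto
    then show ?thesis
      unfolding aux using i that by (auto simp: majorization_matrix_def N_def)
  qed
  have "tensor_apply m n \<A> x $ i = (\<Sum>k<N. C $$ (i, k) * monomial_vec m n x $ k)"
    unfolding tensor using C i
    by (auto simp: scalar_prod_def monomial_vec_def atLeast0LessThan N_def intro!: sum.cong)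
  also have "\<dots> = (\<Sum>k<n. C $$ (i, k) * monomial_vec m n x $ k)"
    using \<open>n \<le> N\<close> entry by (intro sum.mono_neutral_right) auto
  also have "\<dots> = (\<Sum>j<n. majorization_matrix m n \<A> $$ (i, j) * x $ j ^ (m - 1))"
    using \<open>n \<le> N\<close> entry monomial_vec_pure(2)[OF assms(1,2)] by (intro sum.cong) auto
  finally show ?thesis .
qed

text \<open>The inner product of two nonnegative vectors is a sum of nonnegative terms, so it
  vanishes only if each term does.\<close>

lemma TCP_solution_complementary:
  assumes "TCP_solution m n q \<A> \<omega> x" and "q \<in> carrier_vec n" and "i < n"
  shows "x $ i * \<omega> $ i = 0"
proof -
  have dims: "dim_vec x = n" "dim_vec \<omega> = n"
    using assms(1,2) unfolding TCP_solution_def tensor_apply_def by auto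
  have "\<forall>j<n. 0 \<le> x $ j * \<omega> $ j"
    using assms(1) dims unfolding TCP_solution_def less_eq_vec_def by auto
  moreover have "(\<Sum>j<n. x $ j * \<omega> $ j) = 0"
    using assms(1) unfolding TCP_solution_def scalar_prod_def dims(2) atLeast0LessThan by blast
  ultimately show ?thesis
    using sum_nonneg_eq_0_iff[of "{..<n}" "\<lambda>j. x $ j * \<omega> $ j"] assms(3) by auto
qed

lemma omega_solution_carrier:
  "q \<in> carrier_vec n \<Longrightarrow> omega_solution m n q \<A> \<omega> \<Longrightarrow> \<omega> \<in> carrier_vec n"
  unfolding omega_solution_def TCP_solution_def tensor_apply_def by auto

lemma omega_solution_determined_by_zeros:
  assumes "m \<ge> 2" and "n \<ge> 2" and "even m" and cc: "column_competent m n \<A>"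
    and aux: "auxiliary_matrix m n \<A> =
      four_block_mat (majorization_matrix m n \<A>) (0\<^sub>m n (num_monomials m n - n))
        (0\<^sub>m (num_monomials m n - n) n) (0\<^sub>m (num_monomials m n - n) (num_monomials m n - n))"
    and q: "q \<in> carrier_vec n"
    and sol: "omega_solution m n q \<A> \<omega>" "omega_solution m n q \<A> \<omega>'"
    and zeros: "\<And>i. i < n \<Longrightarrow> \<omega> $ i = 0 \<longleftrightarrow> \<omega>' $ i = 0"
  shows "\<omega> = \<omega>'"
proof -
  obtain x x' where x: "TCP_solution m n q \<A> \<omega> x" and x': "TCP_solution m n q \<A> \<omega>' x'"
    using sol unfolding omega_solution_def by blast
  have carr: "x \<in> carrier_vec n" "x' \<in> carrier_vec n"
    and \<omega>: "\<omega> = tensor_apply m n \<A> x + q" "\<omega>' = tensor_apply m n \<A> x' + q"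
    using x x' unfolding TCP_solution_def by auto
  have dim: "dim_vec (tensor_apply m n \<A> z) = n" for z unfolding tensor_apply_def by simp
  \<comment> \<open>The powers may differ by a negative number. As \<open>m - 1\<close> is odd,
    \<open>root (m - 1)\<close> still inverts the power there.\<close>
  define y where "y = vec n (\<lambda>i. root (m - 1) (x $ i ^ (m - 1) - x' $ i ^ (m - 1)))"
  have y: "y \<in> carrier_vec n" unfolding y_def by simp
  have "odd (m - 1)" using assms(1,3) by simp
  then have y_pow: "y $ j ^ (m - 1) = x $ j ^ (m - 1) - x' $ j ^ (m - 1)" if "j < n" for j
    using that unfolding y_def by (simp add: odd_real_root_pow)
  have diff: "tensor_apply m n \<A> y $ i = \<omega> $ i - \<omega>' $ i" if "i < n" for i
  proof -
    \<comment> \<open>By the block form the map is linear in the powers, so \<open>y_pow\<close> can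
      be applied summand by summand.\<close>
    have "tensor_apply m n \<A> y $ i = tensor_apply m n \<A> x $ i - tensor_apply m n \<A> x' $ i"
      unfolding tensor_apply_majorization[OF assms(1,2) aux y that]
        tensor_apply_majorization[OF assms(1,2) aux carr(1) that]
        tensor_apply_majorization[OF assms(1,2) aux carr(2) that]
      unfolding sum_subtractf[symmetric] right_diff_distrib[symmetric]
      by (intro sum.cong refl) (simp only: y_pow lessThan_iff)
    then show ?thesis using \<omega> q that dim by simp
  qed
  have "y $ i * tensor_apply m n \<A> y $ i = 0" if "i < n" for i
  \<comment> \<open>At a common zero the difference of the two solutions vanishes. Elsewhere
    complementarity forces both \<open>x $ i\<close> and \<open>x' $ i\<close> to be 0, hence
    \<open>y $ i\<close> is the root of 0.\<close>
  proof (cases "\<omega> $ i = 0")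
    case True
    then show ?thesis using diff[OF that] zeros[OF that] by simp
  next
    case False
    then have "x $ i = 0" "x' $ i = 0"
      using TCP_solution_complementary[OF x q that] TCP_solution_complementary[OF x' q that]
        zeros[OF that] by auto
    then show ?thesis using that unfolding y_def by simp
  qed
  then have "tensor_apply m n \<A> y = 0\<^sub>v n"
    using cc y unfolding column_competent_def by blast
  then have "\<omega> $ i = \<omega>' $ i" if "i < n" for i using diff[OF that] that by simp
  then show ?thesis
    using omega_solution_carrier[OF q sol(1)] omega_solution_carrier[OF q sol(2)]
    by (intro eq_vecI) auto
qed

lemma vec_dist_pos:
  assumes "v \<in> carrier_vec n" and "w \<in> carrier_vec n" and "v \<noteq> w"
  shows "0 < vec_dist v w"
proof -
  have sq: "(v - w) \<bullet> (v - w) = (\<Sum>i<n. (v $ i - w $ i)\<^sup>2)"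
    using assms(1,2) by (auto simp: scalar_prod_def atLeast0LessThan power2_eq_square)
  obtain i where "i < n" "v $ i \<noteq> w $ i" using assms by (metis carrier_vecD eq_vecI)
  then have "0 < (\<Sum>i<n. (v $ i - w $ i)\<^sup>2)" by (intro sum_pos2[of _ i]) auto
  then show ?thesis unfolding vec_dist_def sq by simp
qed

text \<open>Points of a finite set are isolated: the least distance from \<omega>' to another
  solution is positive and serves as a radius.\<close>

lemma locally_omega_unique_finite:
  assumes fin: "finite {\<omega>. omega_solution m n q \<A> \<omega>}"
    and q: "q \<in> carrier_vec n" and sol: "omega_solution m n q \<A> \<omega>'"
  shows "locally_omega_unique m n q \<A> \<omega>'"
proof -
  define D where "D = (\<lambda>\<omega>. vec_dist \<omega> \<omega>') ` ({\<omega>. omega_solution m n q \<A> \<omega>} - {\<omega>'})"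
  have D: "finite D" "\<forall>d\<in>D. 0 < d"
    using fin vec_dist_pos[OF omega_solution_carrier[OF q] omega_solution_carrier[OF q sol]]
    unfolding D_def by auto
  show ?thesis
    unfolding locally_omega_unique_def
  \<comment> \<open>Inserting 1 keeps the minimum meaningful when \<omega>' is the only solution and
    \<open>D\<close> is empty.\<close>
  proof (intro conjI sol exI[of _ "Min (insert 1 D)"] allI impI)
    show "0 < Min (insert 1 D)" using D by simp
  next
    fix \<omega> assume \<omega>: "omega_solution m n q \<A> \<omega> \<and> vec_dist \<omega> \<omega>' < Min (insert 1 D)"
    then have "vec_dist \<omega> \<omega>' \<notin> D" using D(1) by auto
    then show "\<omega> = \<omega>'" using \<omega> unfolding D_def by blast
  qed
qed

theorem corollary1:
  fixes m n :: nat and \<A> :: "nat list \<Rightarrow> real"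
  assumes "m \<ge> 2" and "n \<ge> 2"
    and "\<A> \<in> tensors m n"
    and "even m"
    and "column_competent m n \<A>"
    and "auxiliary_matrix m n \<A> =
      four_block_mat (majorization_matrix m n \<A>) (0\<^sub>m n (num_monomials m n - n))
        (0\<^sub>m (num_monomials m n - n) n) (0\<^sub>m (num_monomials m n - n) (num_monomials m n - n))"
  shows "\<forall>q\<in>carrier_vec n. \<forall>\<omega>.
    omega_solution m n q \<A> \<omega> \<longrightarrow> locally_omega_unique m n q \<A> \<omega>"
proof (intro ballI allI impI)
  fix q \<omega>
  assume q: "q \<in> carrier_vec n" and sol: "omega_solution m n q \<A> \<omega>"
  \<comment> \<open>Solutions are encoded as subsets of the finite set \<open>{..<n}\<close>; column
    competence makes the encoding injective.\<close>
  let ?zeros = "\<lambda>\<omega> :: real vec. {i. i < n \<and> \<omega> $ i = 0}"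
  have "inj_on ?zeros {\<omega>. omega_solution m n q \<A> \<omega>}"
    by (rule inj_onI, rule omega_solution_determined_by_zeros[OF assms(1,2,4-6) q]) auto
  moreover have "?zeros ` {\<omega>. omega_solution m n q \<A> \<omega>} \<subseteq> Pow {..<n}" by auto
  ultimately have "finite {\<omega>. omega_solution m n q \<A> \<omega>}"
    by (rule inj_on_finite) simp
  then show "locally_omega_unique m n q \<A> \<omega>"
    using q sol by (rule locally_omega_unique_finite)
qed

end
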